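(* Let $\alpha\in\mathbb{R}$ be arbitrary and let $f\colon(0,\infty)\to\mathbb{R}$ be a differentiable function satisfying $$f(b)-f(a)=(b-a)\,f'(S_\alpha(a,b))\quad\text{for all } a,b>0,$$ where $S_\alpha$ is the Stolarsky mean. (i) If $\alpha\notin\{0,1\}$, then there exist constants $c_1,c_2,c_3\in\mathbb{R}$ such that $$f(x)=c_1x^\alpha+c_2x+c_3\quad\text{for all } x>0.$$ (ii) If $\alpha\in\{0,1\}$, then there exist constants $c_1,c_2,c_3\in\mathbb{R}$ such that $$f(x)=c_1x^\alpha\log(x)+c_2x+c_3\quad\text{for all } x>0.$$
   Context: For $\alpha\in\mathbb{R}$, the Stolarsky mean $S_\alpha\colon(0,\infty)^2\to(0,\infty)$ is the continuous function defined as follows. For all $a>0$, $S_\alpha(a,a):=a$. For all $a,b>0$ with $a\neq b$: if $\alpha\notin\{0,1\}$, $$S_\alpha(a,b):=\Bigl(\frac{b^\alpha-a^\alpha}{\alpha(b-a)}\Bigr)^{\frac{1}{\alpha-1}};$$ if $\alpha=0$, $$S_0(a,b):=\frac{b-a}{\log b-\log a};$$ if $\alpha=1$, $$S_1(a,b):=\frac{1}{e}\exp\Bigl(\frac{b\log b-a\log a}{b-a}\Bigr).$$ Here $\log$ is the natural logarithm. *)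

theory Defs
  imports "HOL-Analysis.Analysis"
begin

(* Only meaningful for a, b > 0. For a \<noteq> b the base of the outer power is then positive,
   so powr is the usual real power. *)
definition stolarsky_mean :: "real \<Rightarrow> real \<Rightarrow> real \<Rightarrow> real" where
  "stolarsky_mean \<alpha> a b =
     (if a = b then a
      else if \<alpha> = 0 then (b - a) / (ln b - ln a)
      else if \<alpha> = 1 then (1 / exp 1) * exp ((b * ln b - a * ln a) / (b - a))
      else ((b powr \<alpha> - a powr \<alpha>) / (\<alpha> * (b - a))) powr (1 / (\<alpha> - 1)))"

end

theory Submission
  imports Defs
begin

text \<open>
  The Stolarsky mean is a mean value point: there is a strictly convex \<open>\<phi>\<close> (a multiple of
  \<open>x\<^sup>\<alpha>\<close>, respectively \<open>- ln x\<close> or \<open>x ln x\<close>) such that \<open>S\<^sub>\<alpha>(a, b)\<close> is the unique \<open>m\<close> with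
  \<open>\<phi>'(m) = (\<phi>(b) - \<phi>(a)) / (b - a)\<close>. The hypothesis on \<open>f\<close> thus says that \<open>f\<close> satisfies the mean
  value equation at every point where \<open>\<phi>\<close> does, and the claim is that this forces
  \<open>f = c\<^sub>1 \<phi> + c\<^sub>2 x + c\<^sub>3\<close>. This holds for every strictly convex differentiable \<open>\<phi>\<close> on an open
  interval.

  The functions that satisfy the mean value equation wherever \<open>\<phi>\<close> does form a vector space
  containing \<open>1\<close>, \<open>x\<close> and \<open>\<phi>\<close>. As \<open>\<phi>\<close> is strictly convex, the span of these three functions
  interpolates uniquely at any three points, so it is enough to show that a function \<open>F\<close> of the
  space with zeros \<open>p < q < r\<close> vanishes between \<open>p\<close> and \<open>q\<close> (\<open>zero_of_three_zeros\<close>). The tool is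
  a dictionary between critical points and pairs of equal values: if \<open>m\<close> is the mean value point of
  \<open>a < b\<close>, then \<open>F a = F b\<close> iff \<open>F' m = 0\<close>.

  Suppose \<open>F\<close> were positive on a gap \<open>(u, v)\<close> between two zeros. Then \<open>F\<close> has only one critical
  point in the gap, the mean value point \<open>m\<close> of \<open>u\<close> and \<open>v\<close>: a critical point elsewhere would
  produce a new zero inside the gap (\<open>critical_point_of_gap\<close>). If \<open>F\<close> were nonnegative at points
  \<open>c\<close> just right of \<open>v\<close>, matching \<open>c\<close> with a point of \<open>[u, m)\<close> at the same level would give a
  second critical point in the gap; so \<open>F\<close> becomes negative (\<open>negative_after_positive_gap\<close>).
  If there is a next zero \<open>w\<close>, the mean value point of \<open>u\<close> and \<open>w\<close> is critical and lies strictly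
  between the unique critical points of the gaps \<open>(u, v)\<close> and \<open>(v, w)\<close>, so it must be \<open>v\<close>. But a
  critical point at \<open>v\<close> pairs each point just right of \<open>v\<close> with a point of \<open>(u, v)\<close> where \<open>F\<close> has the
  same value, although the signs differ (\<open>no_zero_after_positive_gap\<close>).
\<close>

section \<open>Divided differences of a strictly convex function\<close>

locale strictly_convex_differentiable =
  fixes I :: "real set" and \<phi> \<phi>' :: "real \<Rightarrow> real"
  assumes open_I: "open I" and convex_I: "convex I"
    and has_deriv: "\<And>x. x \<in> I \<Longrightarrow> (\<phi> has_real_derivative \<phi>' x) (at x)"
    and strict_mono_deriv: "strict_mono_on I \<phi>'"
begin

lemma between_mem: "a \<in> I \<Longrightarrow> b \<in> I \<Longrightarrow> a \<le> x \<Longrightarrow> x \<le> b \<Longrightarrow> x \<in> I"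
  using convex_I by (meson is_interval_convex_1 mem_is_interval_1_I)

lemma deriv_less_iff: "a \<in> I \<Longrightarrow> b \<in> I \<Longrightarrow> \<phi>' a < \<phi>' b \<longleftrightarrow> a < b"
  by (meson strict_mono_deriv strict_mono_on_less)

lemma deriv_eq_iff: "a \<in> I \<Longrightarrow> b \<in> I \<Longrightarrow> \<phi>' a = \<phi>' b \<longleftrightarrow> a = b"
  by (metis deriv_less_iff less_irrefl linorder_neqE)

definition divdiff :: "real \<Rightarrow> real \<Rightarrow> real" where
  "divdiff a b = (\<phi> b - \<phi> a) / (b - a)"

lemma mean_value_point:
  assumes "a \<in> I" "b \<in> I" "a < b"
  obtains m where "a < m" "m < b" "m \<in> I" "divdiff a b = \<phi>' m"
proof -
  have "\<And>x. a \<le> x \<Longrightarrow> x \<le> b \<Longrightarrow> (\<phi> has_real_derivative \<phi>' x) (at x)"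
    using assms between_mem has_deriv by blast
  from MVT2[OF assms(3) this] obtain m where m: "a < m" "m < b" "\<phi> b - \<phi> a = (b - a) * \<phi>' m"
    by blast
  show ?thesis
  proof (rule that[OF m(1,2)])
    show "m \<in> I" using assms m between_mem[of a b m] by simp
    show "divdiff a b = \<phi>' m" using m assms by (simp add: divdiff_def)
  qed
qed

lemma divdiff_bounds:
  assumes "a \<in> I" "b \<in> I" "a < b"
  shows "\<phi>' a < divdiff a b" and "divdiff a b < \<phi>' b"
proof -
  obtain m where "a < m" "m < b" "m \<in> I" "divdiff a b = \<phi>' m"
    using mean_value_point[OF assms] .
  then show "\<phi>' a < divdiff a b" "divdiff a b < \<phi>' b"
    using assms deriv_less_iff by auto
qed

lemma divdiff_increase: "a < b \<Longrightarrow> \<phi> b - \<phi> a = (b - a) * divdiff a b"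
  by (simp add: divdiff_def)

lemma divdiff_split:
  assumes "a < b" "b < c"
  shows "(c - a) * divdiff a c = (b - a) * divdiff a b + (c - b) * divdiff b c"
  using assms by (simp add: divdiff_increase[symmetric])

lemma divdiff_less:
  assumes "a \<in> I" "c \<in> I" "a < b" "b < c"
  shows "divdiff a b < divdiff b c"
proof -
  have "b \<in> I" using assms between_mem[of a c b] by simp
  then show ?thesis
    using divdiff_bounds(2)[of a b] divdiff_bounds(1)[of b c] assms by simp
qed

lemma divdiff_strict_mono:
  assumes "a \<in> I" "c \<in> I" "a < b" "b < c"
  shows "divdiff a b < divdiff a c" and "divdiff a c < divdiff b c"
proof -
  let ?s = "divdiff a b" and ?t = "divdiff b c"
  have st: "?s < ?t" using divdiff_less[OF assms] .
  have "(c - a) * ?s < (c - a) * divdiff a c"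
  proof -
    have "(c - b) * ?s < (c - b) * ?t" using st assms by simp
    then show ?thesis using divdiff_split[OF assms(3,4)] by (simp add: algebra_simps)
  qed
  then show "?s < divdiff a c" using assms by simp
  have "(c - a) * divdiff a c < (c - a) * ?t"
  proof -
    have "(b - a) * ?s < (b - a) * ?t" using st assms by simp
    then show ?thesis using divdiff_split[OF assms(3,4)] by (simp add: algebra_simps)
  qed
  then show "divdiff a c < ?t" using assms by simp
qed

lemma isCont_phi: "x \<in> I \<Longrightarrow> isCont \<phi> x"
  using has_deriv DERIV_isCont by blast

lemma isCont_divdiff_left: "a \<in> I \<Longrightarrow> a \<noteq> b \<Longrightarrow> isCont (\<lambda>x. divdiff x b) a"
  unfolding divdiff_def by (intro continuous_intros isCont_phi) auto

lemma isCont_divdiff_right: "b \<in> I \<Longrightarrow> a \<noteq> b \<Longrightarrow> isCont (divdiff a) b"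
  unfolding divdiff_def[abs_def] by (intro continuous_intros isCont_phi) auto

text \<open>The value of \<open>divdiff\<close> can be adjusted to any prescribed slope by moving one endpoint. These
  two lemmas are how a critical point at \<open>n\<close> yields a pair of points with equal values.\<close>

lemma left_endpoint_with_slope:
  assumes "u \<in> I" "b \<in> I" "u < n" "n < b" "divdiff u b < s" "s < divdiff n b"
  obtains a where "u < a" "a < n" "divdiff a b = s"
proof -
  have "\<forall>x. u \<le> x \<and> x \<le> n \<longrightarrow> isCont (\<lambda>x. divdiff x b) x"
    using assms between_mem[of u b] isCont_divdiff_left by auto
  then obtain a where "u \<le> a" "a \<le> n" "divdiff a b = s"
    using IVT[of "\<lambda>x. divdiff x b" u s n] assms by auto
  with assms that show ?thesis by (metis less_irrefl order_le_less)
qed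

lemma right_endpoint_with_slope:
  assumes "a \<in> I" "v \<in> I" "a < n" "n < v" "divdiff a n < s" "s < divdiff a v"
  obtains b where "n < b" "b < v" "divdiff a b = s"
proof -
  have "\<forall>x. n \<le> x \<and> x \<le> v \<longrightarrow> isCont (divdiff a) x"
    using assms between_mem[of a v] isCont_divdiff_right by auto
  then obtain b where "n \<le> b" "b \<le> v" "divdiff a b = s"
    using IVT[of "divdiff a" n s v] assms by auto
  with assms that show ?thesis by (metis less_irrefl order_le_less)
qed

section \<open>Functions inheriting the mean value points\<close>

definition inherits :: "(real \<Rightarrow> real) \<Rightarrow> (real \<Rightarrow> real) \<Rightarrow> bool" where
  "inherits F F' \<longleftrightarrow>
     (\<forall>x\<in>I. (F has_real_derivative F' x) (at x)) \<and>
     (\<forall>a\<in>I. \<forall>b\<in>I. \<forall>m\<in>I. a < b \<longrightarrow> divdiff a b = \<phi>' m \<longrightarrow> F b - F a = (b - a) * F' m)"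

lemma inherits_uminus:
  assumes "inherits F F'"
  shows "inherits (\<lambda>x. - F x) (\<lambda>x. - F' x)"
  unfolding inherits_def
proof (intro conjI ballI impI)
  fix x assume "x \<in> I"
  then show "((\<lambda>x. - F x) has_real_derivative - F' x) (at x)"
    using assms by (auto simp: inherits_def intro!: DERIV_minus)
next
  fix a b m assume "a \<in> I" "b \<in> I" "m \<in> I" "a < b" "divdiff a b = \<phi>' m"
  then have "F b - F a = (b - a) * F' m" using assms by (auto simp: inherits_def)
  then show "- F b - - F a = (b - a) * - F' m" by simp
qed

lemma inherits_diff_span:
  assumes "inherits F F'"
  shows "inherits (\<lambda>x. F x - (c1 * \<phi> x + c2 * x + c3)) (\<lambda>x. F' x - (c1 * \<phi>' x + c2))"
  unfolding inherits_def
proof (intro conjI ballI impI)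
  fix x assume "x \<in> I"
  then have "(F has_real_derivative F' x) (at x)" "(\<phi> has_real_derivative \<phi>' x) (at x)"
    using assms has_deriv by (auto simp: inherits_def)
  then show "((\<lambda>x. F x - (c1 * \<phi> x + c2 * x + c3)) has_real_derivative
      F' x - (c1 * \<phi>' x + c2)) (at x)"
    by (auto intro!: derivative_eq_intros)
next
  fix a b m assume *: "a \<in> I" "b \<in> I" "m \<in> I" "a < b" "divdiff a b = \<phi>' m"
  then have F: "F b - F a = (b - a) * F' m" using assms by (auto simp: inherits_def)
  have p: "\<phi> b - \<phi> a = (b - a) * \<phi>' m" using * divdiff_increase by metis
  have "F b - (c1 * \<phi> b + c2 * b + c3) - (F a - (c1 * \<phi> a + c2 * a + c3))
      = (F b - F a) - c1 * (\<phi> b - \<phi> a) - c2 * (b - a)" by (simp add: algebra_simps)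
  also have "\<dots> = (b - a) * (F' m - (c1 * \<phi>' m + c2))"
    unfolding F p by (simp add: algebra_simps)
  finally show "F b - (c1 * \<phi> b + c2 * b + c3) - (F a - (c1 * \<phi> a + c2 * a + c3))
      = (b - a) * (F' m - (c1 * \<phi>' m + c2))" .
qed

lemma inherits_isCont: "inherits F F' \<Longrightarrow> x \<in> I \<Longrightarrow> isCont F x"
  unfolding inherits_def using DERIV_isCont by blast

lemma inherits_continuous_on:
  "inherits F F' \<Longrightarrow> a \<in> I \<Longrightarrow> b \<in> I \<Longrightarrow> continuous_on {a..b} F"
  by (intro continuous_at_imp_continuous_on ballI inherits_isCont) (auto intro: between_mem)

lemma critical_iff_equal_values:
  assumes "inherits F F'" "a \<in> I" "b \<in> I" "m \<in> I" "a < b" "divdiff a b = \<phi>' m"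
  shows "F' m = 0 \<longleftrightarrow> F a = F b"
proof -
  have "F b - F a = (b - a) * F' m" using assms by (auto simp: inherits_def)
  then show ?thesis using assms by auto
qed

text \<open>If the slope at a critical point \<open>n\<close> differs from that of the chord over the gap, one of the
  two ends of the gap is paired by \<open>n\<close> with a point inside the gap, which is then a zero.\<close>

lemma critical_point_of_gap:
  assumes F: "inherits F F'" and I: "u \<in> I" "v \<in> I" and n: "u < n" "n < v"
    and zeros: "F u = 0" "F v = 0" and gap: "\<And>x. u < x \<Longrightarrow> x < v \<Longrightarrow> F x \<noteq> 0"
    and crit: "F' n = 0"
  shows "divdiff u v = \<phi>' n"
proof (rule linorder_cases[of "divdiff u v" "\<phi>' n"])
  have nI: "n \<in> I" using I n between_mem[of u v n] by simp
  show ?thesis if less: "divdiff u v < \<phi>' n"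
  proof -
    have "\<phi>' n < divdiff n v" using divdiff_bounds nI I n by simp
    then obtain a where a: "u < a" "a < n" "divdiff a v = \<phi>' n"
      using left_endpoint_with_slope[OF I n less] by blast
    then have "a \<in> I" "a < v" using I n between_mem[of u v a] by auto
    then have "F a = F v"
      using critical_iff_equal_values[OF F _ I(2) nI _ a(3)] crit by simp
    then show ?thesis using gap[OF a(1) \<open>a < v\<close>] zeros by simp
  qed
  show ?thesis if greater: "\<phi>' n < divdiff u v"
  proof -
    have "divdiff u n < \<phi>' n" using divdiff_bounds nI I n by simp
    then obtain b where b: "n < b" "b < v" "divdiff u b = \<phi>' n"
      using right_endpoint_with_slope[OF I n _ greater] by blast
    then have "b \<in> I" "u < b" using I n between_mem[of u v b] by auto
    then have "F u = F b"
      using critical_iff_equal_values[OF F I(1) _ nI _ b(3)] crit by simp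
    then show ?thesis using gap[OF \<open>u < b\<close> b(2)] zeros by simp
  qed
qed

text \<open>A point \<open>c\<close> slightly right of \<open>v\<close> with \<open>F c \<ge> 0\<close> has a partner \<open>a\<close> at the same level in
  \<open>[u, m)\<close>, where \<open>m\<close> is the mean value point of \<open>u < v\<close>. The mean value point of \<open>a < c\<close> is
  critical; it exceeds \<open>m\<close> because \<open>a \<ge> u\<close> and \<open>c > v\<close>, and it stays left of \<open>v\<close> if \<open>c\<close> is close
  to \<open>v\<close>, as \<open>a < m\<close>. So the gap has a second critical point, which is impossible.\<close>

lemma negative_after_positive_gap:
  assumes F: "inherits F F'" and I: "u \<in> I" "v \<in> I" and "u < v"
    and zeros: "F u = 0" "F v = 0" and pos: "\<And>x. u < x \<Longrightarrow> x < v \<Longrightarrow> F x > 0"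
  shows "\<forall>\<^sub>F c in at_right v. F c < 0"
proof -
  obtain m where m: "u < m" "m < v" "m \<in> I" "divdiff u v = \<phi>' m"
    using mean_value_point I \<open>u < v\<close> by blast
  have evI: "\<forall>\<^sub>F c in at_right v. c \<in> I"
    using open_I I(2) by (auto simp: eventually_at_topological)
  have "divdiff m v < \<phi>' v" using divdiff_bounds m I by simp
  moreover have "((divdiff m) \<longlongrightarrow> divdiff m v) (at_right v)"
    using isCont_divdiff_right[OF I(2), of m] m(2)
    by (simp add: isCont_def filterlim_at_split)
  ultimately have ev1: "\<forall>\<^sub>F c in at_right v. divdiff m c < \<phi>' v"
    by (rule order_tendstoD(2)[rotated])
  have "F v < F m" using zeros pos m by simp
  moreover have "(F \<longlongrightarrow> F v) (at_right v)"
    using inherits_isCont[OF F I(2)] by (simp add: isCont_def filterlim_at_split)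
  ultimately have ev2: "\<forall>\<^sub>F c in at_right v. F c < F m"
    by (rule order_tendstoD(2)[rotated])
  have ev3: "\<forall>\<^sub>F c in at_right v. v < c" by (simp add: eventually_at_right_less)
  show ?thesis
    using evI ev1 ev2 ev3
  proof eventually_elim
    case (elim c)
    show "F c < 0"
    proof (rule ccontr)
      assume "\<not> F c < 0"
      then have "\<exists>a\<ge>u. a \<le> m \<and> F a = F c"
        using IVT'[of F u "F c" m] elim zeros m inherits_continuous_on[OF F I(1) m(3)] by auto
      then obtain a where a: "u \<le> a" "a \<le> m" "F a = F c" by blast
      have "a \<noteq> m" using a elim by auto
      then have "a < m" using a by simp
      have aI: "a \<in> I" using a m I between_mem[of u m a] by simp
      have "a < c" using \<open>a < m\<close> m elim by simp
      obtain n where n: "a < n" "n < c" "n \<in> I" "divdiff a c = \<phi>' n"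
        using mean_value_point[OF aI elim(1) \<open>a < c\<close>] .
      have crit: "F' n = 0"
        using critical_iff_equal_values[OF F aI elim(1) n(3) \<open>a < c\<close> n(4)] a by simp
      have "divdiff a c < divdiff m c"
        using divdiff_strict_mono(2)[OF aI elim(1) \<open>a < m\<close>] m elim by simp
      then have "n < v" using n elim deriv_less_iff[OF n(3) I(2)] by simp
      have "divdiff u v \<le> divdiff a v"
        using divdiff_strict_mono(2)[OF I, of a] a \<open>a < m\<close> m by (cases "u = a") auto
      moreover have "divdiff a v < divdiff a c"
        using divdiff_strict_mono(1)[OF aI elim(1)] \<open>a < m\<close> m elim by simp
      ultimately have "m < n" using deriv_less_iff[OF m(3) n(3)] m n by simp
      then have "u < n" using m by simp
      then have "divdiff u v = \<phi>' n"
        using critical_point_of_gap[OF F I _ \<open>n < v\<close> zeros pos[THEN less_imp_neq, symmetric] crit]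
        by simp
      then show False using \<open>m < n\<close> m n deriv_eq_iff by simp
    qed
  qed
qed

lemma first_zero:
  assumes "continuous_on {a..b} (F :: real \<Rightarrow> real)" "a \<le> b" "F b = 0"
  obtains z where "a \<le> z" "z \<le> b" "F z = 0" "\<And>x. a \<le> x \<Longrightarrow> x < z \<Longrightarrow> F x \<noteq> 0"
proof -
  let ?Z = "{x \<in> {a..b}. F x = 0}"
  have "closed ?Z" using assms(1) by (intro continuous_closed_preimage_constant) auto
  then have "compact ({a..b} \<inter> ?Z)" by (intro compact_Int_closed) auto
  then have "compact ?Z" by (rule back_subst[of compact]) auto
  moreover have "?Z \<noteq> {}" using assms by auto
  ultimately obtain z where z: "z \<in> ?Z" "\<forall>x\<in>?Z. z \<le> x" using compact_attains_inf by blast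
  show ?thesis
  proof (rule that)
    fix x assume x: "a \<le> x" "x < z"
    then show "F x \<noteq> 0" using z by force
  qed (use z in auto)
qed

lemma last_zero:
  assumes "continuous_on {a..b} (F :: real \<Rightarrow> real)" "a \<le> b" "F a = 0"
  obtains z where "a \<le> z" "z \<le> b" "F z = 0" "\<And>x. z < x \<Longrightarrow> x \<le> b \<Longrightarrow> F x \<noteq> 0"
proof -
  have "continuous_on {-b..-a} (\<lambda>x. F (- x))"
    using assms(1) by (intro continuous_on_compose2[OF assms(1)] continuous_intros) auto
  then obtain z where z: "-b \<le> z" "z \<le> -a" "F (-z) = 0"
      and nz: "\<And>x. -b \<le> x \<Longrightarrow> x < z \<Longrightarrow> F (-x) \<noteq> 0"
    using first_zero[of "-b" "-a" "\<lambda>x. F (- x)"] assms by auto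
  show ?thesis
  proof (rule that[of "-z"])
    fix x assume "- z < x" "x \<le> b"
    then show "F x \<noteq> 0" using nz[of "-x"] by simp
  qed (use z in auto)
qed

text \<open>After the positive gap \<open>(u, v)\<close> comes a gap \<open>(v, w)\<close> that starts with negative values. The
  mean value point of \<open>u < w\<close> is critical, and its slope lies strictly between the slopes of the
  chords over the two gaps, so it can only be \<open>v\<close>; but the signs of \<open>F\<close> on the two sides of \<open>v\<close>
  exclude that.\<close>

lemma no_zero_after_positive_gap:
  assumes F: "inherits F F'" and I: "u \<in> I" "v \<in> I" "r \<in> I" and uv: "u < v" and "v < r"
    and zeros: "F u = 0" "F v = 0" and pos: "\<And>x. u < x \<Longrightarrow> x < v \<Longrightarrow> F x > 0"
  shows "F r \<noteq> 0"
proof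
  assume r: "F r = 0"
  have neg: "\<forall>\<^sub>F c in at_right v. F c < 0"
    using negative_after_positive_gap[OF F I(1,2) uv zeros pos] .
  then obtain e where e: "v < e" "\<And>c. v < c \<Longrightarrow> c < e \<Longrightarrow> F c < 0"
    unfolding eventually_at_right_field by blast
  have "e \<le> r" using e(2)[OF \<open>v < r\<close>] r by force
  have "e \<in> I" using between_mem[OF I(2,3)] \<open>v < e\<close> \<open>e \<le> r\<close> by simp
  obtain w where w: "e \<le> w" "w \<le> r" "F w = 0" "\<And>x. e \<le> x \<Longrightarrow> x < w \<Longrightarrow> F x \<noteq> 0"
    using first_zero[OF inherits_continuous_on[OF F \<open>e \<in> I\<close> I(3)] \<open>e \<le> r\<close> r] by blast
  have vw: "v < w" and wI: "w \<in> I" using e w between_mem[OF I(2,3), of w] by auto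
  have gap: "F x \<noteq> 0" if "v < x" "x < w" for x
    using e(2)[of x] w(4)[of x] that by fastforce
  have uw: "u < w" using uv vw by simp
  obtain n where n: "u < n" "n < w" "n \<in> I" "divdiff u w = \<phi>' n"
    using mean_value_point[OF I(1) wI uw] .
  have crit: "F' n = 0"
    using critical_iff_equal_values[OF F I(1) wI n(3) uw n(4)] zeros w by simp
  consider "n < v" | "v < n" | "n = v" by linarith
  then show False
  proof cases
    case 1
    then have "divdiff u v = \<phi>' n"
      using critical_point_of_gap[OF F I(1,2) n(1) _ zeros pos[THEN less_imp_neq, symmetric] crit]
      by simp
    then show False using divdiff_strict_mono(1)[OF I(1) wI uv vw] n by simp
  next
    case 2
    then have "divdiff v w = \<phi>' n"
      using critical_point_of_gap[OF F I(2) wI 2 n(2) zeros(2) w(3) gap crit] by simp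
    then show False using divdiff_strict_mono(2)[OF I(1) wI uv vw] n by simp
  next
    case 3
    have "divdiff u v < \<phi>' v" using divdiff_bounds I uv by simp
    moreover have "(divdiff u \<longlongrightarrow> divdiff u v) (at_right v)"
      using isCont_divdiff_right[OF I(2), of u] uv
      by (simp add: isCont_def filterlim_at_split)
    ultimately have "\<forall>\<^sub>F c in at_right v. divdiff u c < \<phi>' v"
      by (rule order_tendstoD(2)[rotated])
    moreover have "\<forall>\<^sub>F c in at_right v. c \<in> {v<..<w}"
      using vw by (rule eventually_at_right_real)
    ultimately have "\<forall>\<^sub>F c in at_right v. divdiff u c < \<phi>' v \<and> c \<in> {v<..<w} \<and> F c < 0"
      using neg by eventually_elim auto
    then obtain c where c: "divdiff u c < \<phi>' v" "v < c" "c < w" "F c < 0"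
      using eventually_happens'[OF trivial_limit_at_right_real] by auto
    have cI: "c \<in> I" using c between_mem[OF I(2) wI] by simp
    obtain a where a: "u < a" "a < v" "divdiff a c = \<phi>' v"
      using left_endpoint_with_slope[OF I(1) cI uv c(2,1)] divdiff_bounds(1)[OF I(2) cI c(2)]
      by blast
    have "a \<in> I" using a between_mem[OF I(1,2), of a] by simp
    then have "F a = F c"
      using critical_iff_equal_values[OF F _ cI I(2) _ a(3)] crit 3 a c by simp
    then show False using pos[OF a(1,2)] c by simp
  qed
qed

lemma nonpos_of_three_zeros:
  assumes F: "inherits F F'" and I: "p \<in> I" "r \<in> I" and "p \<le> x" "x \<le> q" "q < r"
    and zeros: "F p = 0" "F q = 0" "F r = 0"
  shows "F x \<le> 0"
proof (rule ccontr)
  assume "\<not> F x \<le> 0"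
  then have x: "F x > 0" by simp
  have xI: "x \<in> I" and qI: "q \<in> I"
    using assms between_mem[OF I] by auto
  obtain u where u: "p \<le> u" "u \<le> x" "F u = 0" "\<And>y. u < y \<Longrightarrow> y \<le> x \<Longrightarrow> F y \<noteq> 0"
    using last_zero[OF inherits_continuous_on[OF F I(1) xI] \<open>p \<le> x\<close> zeros(1)] by blast
  obtain v where v: "x \<le> v" "v \<le> q" "F v = 0" "\<And>y. x \<le> y \<Longrightarrow> y < v \<Longrightarrow> F y \<noteq> 0"
    using first_zero[OF inherits_continuous_on[OF F xI qI] \<open>x \<le> q\<close> zeros(2)] by blast
  have uI: "u \<in> I" using between_mem[OF I(1) xI u(1,2)] .
  have vI: "v \<in> I" using between_mem[OF xI qI v(1,2)] .
  have "u \<noteq> x" "v \<noteq> x" using u v x by auto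
  then have "u < x" "x < v" using u v by auto
  have pos: "F y > 0" if y: "u < y" "y < v" for y
  proof (rule ccontr)
    assume "\<not> F y > 0"
    have yI: "y \<in> I" using y uI vI between_mem[of u v y] by simp
    show False
    proof (cases "y \<le> x")
      case True
      then obtain z where "y \<le> z" "z \<le> x" "F z = 0"
        using IVT'[of F y 0 x] inherits_continuous_on[OF F yI xI] x \<open>\<not> F y > 0\<close> by auto
      then show False using u(4)[of z] y by simp
    next
      case False
      then obtain z where "x \<le> z" "z \<le> y" "F z = 0"
        using IVT2'[of F y 0 x] inherits_continuous_on[OF F xI yI] x \<open>\<not> F y > 0\<close> by auto
      then show False using v(4)[of z] y by simp
    qed
  qed
  then show False
    using no_zero_after_positive_gap[OF F uI vI I(2) _ _ u(3) v(3) pos] \<open>u < x\<close> \<open>x < v\<close> v(2)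
      \<open>q < r\<close> zeros(3) by simp
qed

lemma zero_of_three_zeros:
  assumes F: "inherits F F'" and I: "p \<in> I" "r \<in> I" and x: "p \<le> x" "x \<le> q" "q < r"
    and zeros: "F p = 0" "F q = 0" "F r = 0"
  shows "F x = 0"
  using nonpos_of_three_zeros[OF F I x zeros] nonpos_of_three_zeros[OF inherits_uminus[OF F] I x]
    zeros by simp

section \<open>Interpolation at three points\<close>

lemma interpolate_three_points:
  assumes I: "p \<in> I" "r \<in> I" and pqr: "p < q" "q < r"
  obtains c1 c2 c3 where "\<And>x. x \<in> {p, q, r} \<Longrightarrow> F x = c1 * \<phi> x + c2 * x + c3"
proof -
  define s t where "s = divdiff p q" and "t = divdiff q r"
  define S T where "S = (F q - F p) / (q - p)" and "T = (F r - F q) / (r - q)"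
  have "s < t" using divdiff_less[OF I pqr] by (simp add: s_def t_def)
  define c1 where "c1 = (T - S) / (t - s)"
  define c2 where "c2 = S - c1 * s"
  define c3 where "c3 = F q - c1 * \<phi> q - c2 * q"
  have c1: "c1 * (t - s) = T - S" using \<open>s < t\<close> by (simp add: c1_def)
  have Fq: "F q - F p = (q - p) * S" and Fr: "F r - F q = (r - q) * T"
    using pqr by (simp_all add: S_def T_def)
  have pq: "\<phi> q - \<phi> p = (q - p) * s" and pr: "\<phi> r - \<phi> q = (r - q) * t"
    using pqr by (simp_all add: s_def t_def divdiff_increase)
  have S: "S = c1 * s + c2" by (simp add: c2_def)
  have T: "T = c1 * t + c2" using c1 S by (simp add: algebra_simps)
  show ?thesis
  proof (rule that)
    fix x assume x: "x \<in> {p, q, r}"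
    have q: "F q = c1 * \<phi> q + c2 * q + c3" by (simp add: c3_def)
    have "F q - F p = c1 * (\<phi> q - \<phi> p) + c2 * (q - p)"
      unfolding Fq pq S by (simp add: algebra_simps)
    then have p: "F p = c1 * \<phi> p + c2 * p + c3" using q by (simp add: algebra_simps)
    have "F r - F q = c1 * (\<phi> r - \<phi> q) + c2 * (r - q)"
      unfolding Fr pr T by (simp add: algebra_simps)
    then have "F r = c1 * \<phi> r + c2 * r + c3" using q by (simp add: algebra_simps)
    then show "F x = c1 * \<phi> x + c2 * x + c3" using x p q by (elim insertE) simp_all
  qed
qed

lemma span_zero_of_three_zeros:
  assumes I: "p \<in> I" "r \<in> I" and pqr: "p < q" "q < r"
    and zero: "\<And>x. x \<in> {p, q, r} \<Longrightarrow> c1 * \<phi> x + c2 * x + c3 = 0"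
  shows "c1 = 0" "c2 = 0" "c3 = 0"
proof -
  have "(q - p) * (c1 * divdiff p q + c2) = 0"
  proof -
    have "(q - p) * (c1 * divdiff p q + c2) = c1 * (\<phi> q - \<phi> p) + c2 * (q - p)"
      unfolding divdiff_increase[OF pqr(1)] by (simp add: algebra_simps)
    then show ?thesis using zero[of p] zero[of q] by (simp add: algebra_simps)
  qed
  then have 1: "c1 * divdiff p q + c2 = 0" using pqr by simp
  have "(r - q) * (c1 * divdiff q r + c2) = 0"
  proof -
    have "(r - q) * (c1 * divdiff q r + c2) = c1 * (\<phi> r - \<phi> q) + c2 * (r - q)"
      unfolding divdiff_increase[OF pqr(2)] by (simp add: algebra_simps)
    then show ?thesis using zero[of q] zero[of r] by (simp add: algebra_simps)
  qed
  then have 2: "c1 * divdiff q r + c2 = 0" using pqr by simp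
  have "c1 * divdiff p q = c1 * divdiff q r" using 1 2 by linarith
  then show c1: "c1 = 0" using divdiff_less[OF I pqr] by simp
  then show c2: "c2 = 0" using 1 by simp
  show "c3 = 0" using c1 c2 zero[of p] by simp
qed

text \<open>The interpolant of \<open>f\<close> at three points agrees with \<open>f\<close> only on a bounded interval at first.
  Every larger interval has an interpolant too, and by uniqueness it is the same one.\<close>

theorem inherits_imp_span:
  assumes F: "inherits f f'" and "I \<noteq> {}"
  obtains c1 c2 c3 where "\<And>x. x \<in> I \<Longrightarrow> f x = c1 * \<phi> x + c2 * x + c3"
proof -
  have right: "\<exists>y\<in>I. x < y" if x: "x \<in> I" for x
  proof -
    obtain e where "e > 0" "ball x e \<subseteq> I" using open_I x openE by blast
    then have "x + e / 2 \<in> I" by (auto simp: dist_real_def)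
    then show ?thesis using \<open>e > 0\<close> by (intro bexI[of _ "x + e / 2"]) auto
  qed
  obtain p where p: "p \<in> I" using \<open>I \<noteq> {}\<close> by blast
  obtain q where q: "q \<in> I" "p < q" using right p by blast
  obtain r where r: "r \<in> I" "q < r" using right q by blast
  obtain c1 c2 c3 where c: "\<And>x. x \<in> {p, q, r} \<Longrightarrow> f x = c1 * \<phi> x + c2 * x + c3"
    using interpolate_three_points[OF p r(1) q(2) r(2), of f] by blast
  let ?F = "\<lambda>x. f x - (c1 * \<phi> x + c2 * x + c3)"
  have inh: "inherits ?F (\<lambda>x. f' x - (c1 * \<phi>' x + c2))" using inherits_diff_span[OF F] .
  show ?thesis
  proof (rule that[of c1 c2 c3])
    fix x assume x: "x \<in> I"
    define P Q where "P = min x p" and "Q = max x r"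
    have PQ: "P \<in> I" "Q \<in> I" "P < Q" using x p q r by (auto simp: P_def Q_def min_def max_def)
    obtain R where R: "R \<in> I" "Q < R" using right PQ by blast
    obtain d1 d2 d3 where d: "\<And>y. y \<in> {P, Q, R} \<Longrightarrow> ?F y = d1 * \<phi> y + d2 * y + d3"
      using interpolate_three_points[OF PQ(1) R(1) PQ(3) R(2), of ?F] by blast
    have agree: "?F y = d1 * \<phi> y + d2 * y + d3" if "P \<le> y" "y \<le> Q" for y
      using zero_of_three_zeros[OF inherits_diff_span[OF inh, of d1 d2 d3] PQ(1) R(1) that R(2)] d
      by simp
    have "d1 * \<phi> y + d2 * y + d3 = 0" if "y \<in> {p, q, r}" for y
    proof -
      have "P \<le> y" "y \<le> Q" using that q r by (auto simp: P_def Q_def)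
      then show ?thesis using agree[of y] c[OF that] by simp
    qed
    note zero = span_zero_of_three_zeros[OF p r(1) q(2) r(2) this]
    then show "f x = c1 * \<phi> x + c2 * x + c3"
      using agree[of x] zero by (simp add: P_def Q_def)
  qed
qed

end

section \<open>The Stolarsky mean as a mean value point\<close>

text \<open>The factor \<open>1 / (\<alpha> (\<alpha> - 1))\<close> turns the second derivative into \<open>x\<^sup>\<alpha>\<^sup>-\<^sup>2\<close>, so that the function
  is strictly convex for every \<open>\<alpha>\<close>; the two exceptional cases have the same second derivative.\<close>

definition stolarsky_potential :: "real \<Rightarrow> real \<Rightarrow> real" where
  "stolarsky_potential \<alpha> x =
     (if \<alpha> = 0 then - ln x
      else if \<alpha> = 1 then x * ln x
      else x powr \<alpha> / (\<alpha> * (\<alpha> - 1)))"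

definition stolarsky_slope :: "real \<Rightarrow> real \<Rightarrow> real" where
  "stolarsky_slope \<alpha> x = (if \<alpha> = 1 then ln x + 1 else x powr (\<alpha> - 1) / (\<alpha> - 1))"

lemma stolarsky_potential_has_derivative:
  assumes "x > 0"
  shows "(stolarsky_potential \<alpha> has_real_derivative stolarsky_slope \<alpha> x) (at x)"
proof -
  consider "\<alpha> = 0" | "\<alpha> = 1" | "\<alpha> \<noteq> 0" "\<alpha> \<noteq> 1" by blast
  then show ?thesis
  proof cases
    case 1
    then show ?thesis
      using assms unfolding stolarsky_potential_def stolarsky_slope_def
      by (auto intro!: derivative_eq_intros simp: powr_minus inverse_eq_divide)
  next
    case 2
    then show ?thesis
      using assms unfolding stolarsky_potential_def stolarsky_slope_def
      by (auto intro!: derivative_eq_intros)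
  next
    case 3
    then show ?thesis
      using assms unfolding stolarsky_potential_def stolarsky_slope_def
      by (auto intro!: derivative_eq_intros)
  qed
qed

lemma strict_mono_stolarsky_slope: "strict_mono_on {0<..} (stolarsky_slope \<alpha>)"
proof (rule strict_mono_onI)
  fix x y :: real assume "x \<in> {0<..}" "y \<in> {0<..}" "x < y"
  then have xy: "0 < x" "x < y" by auto
  consider "\<alpha> = 1" | "\<alpha> > 1" | "\<alpha> < 1" by linarith
  then show "stolarsky_slope \<alpha> x < stolarsky_slope \<alpha> y"
  proof cases
    case 1 then show ?thesis using xy by (simp add: stolarsky_slope_def)
  next
    case 2 then show ?thesis
      using xy powr_less_mono2[of "\<alpha> - 1" x y]
      by (auto simp: stolarsky_slope_def intro!: divide_strict_right_mono)
  next
    case 3 then show ?thesis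
      using xy powr_less_mono2_neg[of "\<alpha> - 1" x y]
      by (auto simp: stolarsky_slope_def intro!: divide_strict_right_mono_neg)
  qed
qed

interpretation stolarsky:
  strictly_convex_differentiable "{0<..}" "stolarsky_potential \<alpha>" "stolarsky_slope \<alpha>" for \<alpha>
  by unfold_locales
    (auto simp: stolarsky_potential_has_derivative strict_mono_stolarsky_slope)

lemma stolarsky_slope_mean:
  assumes "0 < a" "a < b"
  shows "stolarsky_mean \<alpha> a b > 0"
    and "stolarsky_slope \<alpha> (stolarsky_mean \<alpha> a b) = stolarsky.divdiff \<alpha> a b"
proof -
  have b: "0 < b" "a \<noteq> b" "b - a > 0" "ln a < ln b" using assms by auto
  consider "\<alpha> = 0" | "\<alpha> = 1" | "\<alpha> \<noteq> 0" "\<alpha> \<noteq> 1" by blast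
  then have "stolarsky_mean \<alpha> a b > 0 \<and>
      stolarsky_slope \<alpha> (stolarsky_mean \<alpha> a b) = stolarsky.divdiff \<alpha> a b"
  proof cases
    case 1
    have "stolarsky_mean \<alpha> a b = (b - a) / (ln b - ln a)" using 1 b by (simp add: stolarsky_mean_def)
    moreover have "(b - a) / (ln b - ln a) > 0" using b by simp
    moreover have "stolarsky_slope \<alpha> ((b - a) / (ln b - ln a)) = stolarsky.divdiff \<alpha> a b"
      using 1 b
      by (simp add: stolarsky_slope_def stolarsky.divdiff_def stolarsky_potential_def powr_minus
          minus_divide_left)
    ultimately show ?thesis by simp
  next
    case 2
    have "stolarsky_mean \<alpha> a b = exp ((b * ln b - a * ln a) / (b - a) - 1)"
      using 2 b by (simp add: stolarsky_mean_def exp_diff)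
    then show ?thesis
      using 2 by (simp add: stolarsky_slope_def stolarsky.divdiff_def stolarsky_potential_def)
  next
    case 3
    let ?B = "(b powr \<alpha> - a powr \<alpha>) / (\<alpha> * (b - a))"
    have "?B > 0"
    proof (cases "\<alpha> > 0")
      case True
      then show ?thesis using powr_less_mono2[of \<alpha> a b] assms b by simp
    next
      case False
      then have "\<alpha> < 0" using 3 by simp
      then have "b powr \<alpha> - a powr \<alpha> < 0" "\<alpha> * (b - a) < 0"
        using powr_less_mono2_neg[of \<alpha> a b] assms b by (auto simp: mult_neg_pos)
      then show ?thesis by (rule divide_neg_neg)
    qed
    moreover have "b powr \<alpha> \<noteq> a powr \<alpha>" using \<open>?B > 0\<close> by auto
    moreover have m: "stolarsky_mean \<alpha> a b = ?B powr (1 / (\<alpha> - 1))"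
      using 3 b by (simp add: stolarsky_mean_def)
    moreover have "stolarsky_mean \<alpha> a b powr (\<alpha> - 1) = ?B"
      unfolding m powr_powr using 3 powr_one[OF less_imp_le[OF \<open>?B > 0\<close>]] by simp
    ultimately show ?thesis
      using 3 b
      by (simp add: stolarsky_slope_def stolarsky.divdiff_def stolarsky_potential_def
          diff_divide_distrib[symmetric] mult_ac)
  qed
  then show "stolarsky_mean \<alpha> a b > 0"
    and "stolarsky_slope \<alpha> (stolarsky_mean \<alpha> a b) = stolarsky.divdiff \<alpha> a b" by auto
qed

theorem theorem1:
  fixes \<alpha> :: real and f :: "real \<Rightarrow> real"
  assumes "f differentiable_on {0<..}"
    and "\<And>a b. a > 0 \<Longrightarrow> b > 0 \<Longrightarrow> f b - f a = (b - a) * deriv f (stolarsky_mean \<alpha> a b)"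
  shows "(\<alpha> \<notin> {0, 1} \<longrightarrow>
            (\<exists>c1 c2 c3. \<forall>x>0. f x = c1 * x powr \<alpha> + c2 * x + c3)) \<and>
         (\<alpha> \<in> {0, 1} \<longrightarrow>
            (\<exists>c1 c2 c3. \<forall>x>0. f x = c1 * x powr \<alpha> * ln x + c2 * x + c3))"
proof -
  have "stolarsky.inherits \<alpha> f (deriv f)"
    unfolding stolarsky.inherits_def
  proof (intro conjI ballI impI)
    fix x :: real assume "x \<in> {0<..}"
    then show "(f has_real_derivative deriv f x) (at x)"
      using assms(1) by (metis DERIV_deriv_iff_real_differentiable at_within_open
          differentiable_on_def open_greaterThan)
  next
    fix a b m :: real
    assume *: "a \<in> {0<..}" "b \<in> {0<..}" "m \<in> {0<..}" "a < b"
      "stolarsky.divdiff \<alpha> a b = stolarsky_slope \<alpha> m"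
    then have "stolarsky_mean \<alpha> a b = m"
      using stolarsky_slope_mean[of a b \<alpha>] stolarsky.deriv_eq_iff[of "stolarsky_mean \<alpha> a b" m \<alpha>]
      by simp
    then show "f b - f a = (b - a) * deriv f m" using assms(2)[of a b] * by simp
  qed
  then obtain c1 c2 c3
    where c: "\<And>x. x \<in> {0<..} \<Longrightarrow> f x = c1 * stolarsky_potential \<alpha> x + c2 * x + c3"
    using stolarsky.inherits_imp_span[OF \<open>stolarsky.inherits \<alpha> f (deriv f)\<close>] by auto
  show ?thesis
  proof (intro conjI impI)
    assume "\<alpha> \<notin> {0, 1}"
    then have "\<forall>x>0. f x = c1 / (\<alpha> * (\<alpha> - 1)) * x powr \<alpha> + c2 * x + c3"
      using c by (auto simp: stolarsky_potential_def)
    then show "\<exists>c1 c2 c3. \<forall>x>0. f x = c1 * x powr \<alpha> + c2 * x + c3" by blast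
  next
    assume "\<alpha> \<in> {0, 1}"
    then have "\<forall>x>0. f x = (if \<alpha> = 0 then - c1 else c1) * x powr \<alpha> * ln x + c2 * x + c3"
      using c by (auto simp: stolarsky_potential_def)
    then show "\<exists>c1 c2 c3. \<forall>x>0. f x = c1 * x powr \<alpha> * ln x + c2 * x + c3" by blast
  qed
qed

end
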